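(* Let $\mathcal{P}$ be a dynamical pair assignment and let $X$ be a compact metrizable space. Then $F(\mathcal{P}_X)=\{T\in C(X,X): \mathcal{P}_X(T)=X^2\}$ is a Borel subset of $C(X,X)$.
   Context: A topological dynamical system (TDS) $(X,T)$ is a compact metrizable space $X$ with a continuous map $T\colon X\to X$. A factor map $\varphi\colon (X,T)\to(X_1,T_1)$ between TDSs is a continuous surjection $\varphi\colon X\to X_1$ with $\varphi\circ T=T_1\circ\varphi$. $C(X,X)$ is the set of continuous self-maps of $X$ with the uniform topology; $K(Y)$ is the space of compact subsets of $Y$ with the Vietoris topology (Hausdorff metric). A set $A\subseteq X^2$ is $T\times T$-invariant if $(T\times T)(A)\subseteq A$. A dynamical pair assignment $\mathcal{P}$ is a collection of maps $\mathcal{P}_X\colon C(X,X)\to K(X^2)$, one for each compact metrizable space $X$, such that: (1) $\mathcal{P}_X(T)$ is $T\times T$-invariant for every $T\in C(X,X)$; (2) if $\varphi\colon (X,T)\to (X_1,T_1)$ is a factor map and $(x,y)\in\mathcal{P}_X(T)$, then $(\varphi(x),\varphi(y))\in\mathcal{P}_{X_1}(T_1)$; (3) each $\mathcal{P}_X$ is a Borel map. A TDS $(X,T)$ is called $\mathcal{P}$-full if $\mathcal{P}_X(T)=X^2$; thus $F(\mathcal{P}_X)$ is the set of $T$ for which $(X,T)$ is $\mathcal{P}$-full. *)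

theory Defs
  imports "HOL-Analysis.Analysis"
begin

definition borel_of :: "'a topology \<Rightarrow> 'a measure" where
  "borel_of X = sigma (topspace X) {U. openin X U}"

text \<open>The empty set is a point of this space: it is a compact subset, and it is isolated in
  the Vietoris topology.\<close>

definition vietoris :: "'a topology \<Rightarrow> 'a set topology" where
  "vietoris Y = topology_generated_by
     ({{K. compactin Y K \<and> K \<subseteq> U} |U. openin Y U} \<union>
      {{K. compactin Y K \<and> K \<inter> U \<noteq> {}} |U. openin Y U})"

lemma topspace_vietoris: "topspace (vietoris Y) = {K. compactin Y K}"
proof -
  have "{K. compactin Y K} = {K. compactin Y K \<and> K \<subseteq> topspace Y}"
    by (auto dest: compactin_subset_topspace)
  then have "{K. compactin Y K} \<in> {{K. compactin Y K \<and> K \<subseteq> U} |U. openin Y U}"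
    using openin_topspace[of Y] by (intro CollectI exI[of _ "topspace Y"] conjI)
  moreover have "A \<subseteq> {K. compactin Y K}"
    if "A \<in> {{K. compactin Y K \<and> K \<subseteq> U} |U. openin Y U} \<union>
            {{K. compactin Y K \<and> K \<inter> U \<noteq> {}} |U. openin Y U}" for A
    using that by auto
  ultimately show ?thesis
    unfolding vietoris_def topology_generated_by_topspace
    by (intro subset_antisym Union_upper Union_least UnI1)
qed

text \<open>Maps out of a space are represented by functions that are \<^const>\<open>undefined\<close> off
  \<open>topspace X\<close>, so that a continuous self-map is a single HOL function. The metric chosen here
  is immaterial, see \<open>self_maps_eq\<close> below.\<close>

definition self_maps :: "'a topology \<Rightarrow> ('a \<Rightarrow> 'a) topology" where
  "self_maps X = mtopology_of (cfunspace X (SOME m. mtopology_of m = X))"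

lemma metrizable_space_ex_metric:
  assumes "metrizable_space X"
  shows "\<exists>m. mtopology_of m = X"
proof -
  obtain M d where "Metric_space M d" and X: "X = Metric_space.mtopology M d"
    using assms by (auto simp: metrizable_space_def)
  then have "mtopology_of (metric (M, d)) = X"
    by (simp add: mtopology_of_def Metric_space.mspace_metric Metric_space.mdist_metric)
  then show ?thesis ..
qed

lemma mspace_cfunspace_self:
  assumes "compact_space X" "mtopology_of m = X"
  shows "mspace (cfunspace X m) = {T. continuous_map X X T \<and> T \<in> extensional (topspace X)}"
proof -
  have "compactin X (topspace X)"
    using assms(1) by (simp add: compact_space_def)
  moreover have mspace: "mspace m = topspace X"
    using assms(2) by auto
  moreover have "(\<forall>x\<in>topspace X. f x \<in> topspace X)" if "continuous_map X X f" for f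
    using that by (simp add: continuous_map_def Pi_iff)
  ultimately show ?thesis
    unfolding compactin_mspace_cfunspace[OF \<open>compactin X (topspace X)\<close>] assms(2) mspace
    by (intro Collect_cong) blast
qed

lemma continuous_id_cfunspace:
  assumes X: "compact_space X" and m: "mtopology_of m = X" and m': "mtopology_of m' = X"
  shows "continuous_map (mtopology_of (cfunspace X m)) (mtopology_of (cfunspace X m')) (\<lambda>f. f)"
proof (cases "topspace X = {}")
  case True
  then have zero: "mdist (cfunspace X m') f g = 0" for f g
    unfolding mdist_cfunspace_eq_mdist_funspace mdist_funspace
    by (simp add: Metric_space.fdist_def[OF Metric_space_mspace_mdist])
  have "uniformly_continuous_map (cfunspace X m) (cfunspace X m') (\<lambda>f. f)"
    unfolding uniformly_continuous_map_def zero
    unfolding mspace_cfunspace_self[OF X m] mspace_cfunspace_self[OF X m']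
    by (meson Pi_I zero_less_one)
  then show ?thesis
    by (rule uniformly_continuous_imp_continuous_map)
next
  case False
  have ms: "mspace m = topspace X" "mspace m' = topspace X"
    using m m' by (metis topspace_mtopology_of)+
  have "continuous_map (mtopology_of m) (mtopology_of m') (\<lambda>x. x)"
    using m m' by simp
  then have "uniformly_continuous_map m m' (\<lambda>x. x)"
    using X m by (intro continuous_eq_uniformly_continuous_map[THEN iffD1]) auto
  then have uc: "\<exists>\<delta>>0. \<forall>x\<in>topspace X. \<forall>y\<in>topspace X. mdist m y x < \<delta> \<longrightarrow> mdist m' y x < \<epsilon>"
    if "\<epsilon> > 0" for \<epsilon>
    using that by (simp add: uniformly_continuous_map_def ms)
  have "uniformly_continuous_map (cfunspace X m) (cfunspace X m') (\<lambda>f. f)"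
    unfolding uniformly_continuous_map_def
  proof (intro conjI allI impI)
    show "(\<lambda>f. f) \<in> mspace (cfunspace X m) \<rightarrow> mspace (cfunspace X m')"
      unfolding mspace_cfunspace_self[OF X m] mspace_cfunspace_self[OF X m'] by simp
    fix \<epsilon> :: real assume "0 < \<epsilon>"
    then obtain \<delta> where "\<delta> > 0" and
      \<delta>: "\<And>x y. \<lbrakk>x \<in> topspace X; y \<in> topspace X; mdist m y x < \<delta>\<rbrakk> \<Longrightarrow> mdist m' y x < \<epsilon>/2"
      using uc[of "\<epsilon>/2"] by auto
    have "mdist (cfunspace X m') g f < \<epsilon>"
      if f: "f \<in> mspace (cfunspace X m)" and g: "g \<in> mspace (cfunspace X m)"
        and less: "mdist (cfunspace X m) g f < \<delta>" for f g
    proof -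
      have f': "f \<in> mspace (cfunspace X m')" and g': "g \<in> mspace (cfunspace X m')"
        using f g unfolding mspace_cfunspace_self[OF X m] mspace_cfunspace_self[OF X m'] by auto
      have "mdist m' (g x) (f x) \<le> \<epsilon>/2" if x: "x \<in> topspace X" for x
      proof -
        have "mdist m (g x) (f x) < \<delta>"
          using mdist_cfunspace_imp_mdist_le[OF g f order_refl x] less by simp
        moreover have "f x \<in> topspace X" "g x \<in> topspace X"
          using f g x unfolding mspace_cfunspace_self[OF X m] by (auto simp: continuous_map_def)
        ultimately show ?thesis
          using \<delta> by fastforce
      qed
      then have "mdist (cfunspace X m') g f \<le> \<epsilon>/2"
        using cfunspace_mdist_le[OF g' f' False] by blast
      then show ?thesis using \<open>0 < \<epsilon>\<close> by simp
    qed
    then show "\<exists>\<delta>>0. \<forall>f\<in>mspace (cfunspace X m). \<forall>g\<in>mspace (cfunspace X m).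
        mdist (cfunspace X m) g f < \<delta> \<longrightarrow> mdist (cfunspace X m') g f < \<epsilon>"
      using \<open>\<delta> > 0\<close> by blast
  qed
  then show ?thesis
    by (rule uniformly_continuous_imp_continuous_map)
qed

lemma self_maps_eq:
  assumes X: "compact_space X" and m: "mtopology_of m = X"
  shows "self_maps X = mtopology_of (cfunspace X m)"
proof -
  define m' where "m' = (SOME m. mtopology_of m = X)"
  have m': "mtopology_of m' = X"
    unfolding m'_def using m by (rule someI)
  have "homeomorphic_maps (mtopology_of (cfunspace X m')) (mtopology_of (cfunspace X m))
          id id"
    using continuous_id_cfunspace[OF X m m'] continuous_id_cfunspace[OF X m' m]
    by (simp add: homeomorphic_maps_def id_def)
  then have "mtopology_of (cfunspace X m') = mtopology_of (cfunspace X m)"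
    by (metis homeomorphic_maps_id)
  then show ?thesis
    by (simp add: self_maps_def m'_def)
qed

lemma topspace_self_maps:
  assumes "compact_space X" "metrizable_space X"
  shows "topspace (self_maps X) = {T. continuous_map X X T \<and> T \<in> extensional (topspace X)}"
proof -
  obtain m where m: "mtopology_of m = X"
    using metrizable_space_ex_metric[OF assms(2)] by blast
  then show ?thesis
    unfolding self_maps_eq[OF assms(1) m] topspace_mtopology_of
    by (rule mspace_cfunspace_self[OF assms(1)])
qed

definition tds :: "'a topology \<Rightarrow> ('a \<Rightarrow> 'a) \<Rightarrow> bool" where
  "tds X T \<longleftrightarrow> compact_space X \<and> metrizable_space X \<and> T \<in> topspace (self_maps X)"

definition factor_map ::
    "'a topology \<Rightarrow> ('a \<Rightarrow> 'a) \<Rightarrow> 'b topology \<Rightarrow> ('b \<Rightarrow> 'b) \<Rightarrow> ('a \<Rightarrow> 'b) \<Rightarrow> bool" where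
  "factor_map X T X1 T1 \<phi> \<longleftrightarrow>
     tds X T \<and> tds X1 T1 \<and>
     continuous_map X X1 \<phi> \<and> \<phi> ` topspace X = topspace X1 \<and>
     (\<forall>x\<in>topspace X. \<phi> (T x) = T1 (\<phi> x))"

text \<open>The assignment ranges over all compact metrizable spaces whose points lie in the type
  \<open>'a\<close>. Every compact metrizable space has at most continuum many points, so for a type such as
  \<^typ>\<open>nat \<Rightarrow> real\<close> these are all compact metrizable spaces up to homeomorphism. Values of
  \<open>P\<close> at other topologies, or at functions outside \<open>self_maps X\<close>, are irrelevant.\<close>

definition dynamical_pair_assignment ::
    "('a topology \<Rightarrow> ('a \<Rightarrow> 'a) \<Rightarrow> ('a \<times> 'a) set) \<Rightarrow> bool" where
  "dynamical_pair_assignment P \<longleftrightarrow>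
     (\<forall>X T. tds X T \<longrightarrow> compactin (prod_topology X X) (P X T)) \<and>
     (\<forall>X T. tds X T \<longrightarrow> map_prod T T ` P X T \<subseteq> P X T) \<and>
     (\<forall>X T X1 T1 \<phi> x y. factor_map X T X1 T1 \<phi> \<longrightarrow>
        (x, y) \<in> P X T \<longrightarrow> (\<phi> x, \<phi> y) \<in> P X1 T1) \<and>
     (\<forall>X. compact_space X \<longrightarrow> metrizable_space X \<longrightarrow>
        P X \<in> borel_of (self_maps X) \<rightarrow>\<^sub>M borel_of (vietoris (prod_topology X X)))"

definition pair_full ::
    "('a topology \<Rightarrow> ('a \<Rightarrow> 'a) \<Rightarrow> ('a \<times> 'a) set) \<Rightarrow> 'a topology \<Rightarrow> ('a \<Rightarrow> 'a) \<Rightarrow> bool" where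
  "pair_full P X T \<longleftrightarrow> P X T = topspace X \<times> topspace X"

end

theory Submission
  imports Defs
begin

text \<open>The set of full maps is the preimage under the Borel map \<open>P X\<close> of one point
  of the hyperspace of X \<times> X, namely the whole square. So it suffices that this point forms a
  Borel set, and it is even closed: by \<open>closedin_vietoris_topspace\<close>, the compact sets
  that miss some point form a union of basic Vietoris-open sets.\<close>

lemma space_borel_of: "space (borel_of X) = topspace X"
  by (simp add: borel_of_def space_measure_of_conv)

lemma borel_of_open:
  assumes "openin X U"
  shows "U \<in> sets (borel_of X)"
proof -
  have "{U. openin X U} \<subseteq> Pow (topspace X)"
    by (auto dest: openin_subset)
  with assms show ?thesis
    by (simp add: borel_of_def sets_measure_of sigma_sets.Basic)
qed

lemma borel_of_closed:
  assumes "closedin X S"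
  shows "S \<in> sets (borel_of X)"
proof -
  have "topspace X - (topspace X - S) \<in> sets (borel_of X)"
    using assms borel_of_open[of X "topspace X - S"]
    by (metis closedin_def sets.compl_sets space_borel_of)
  then show ?thesis
    using closedin_subset[OF assms] by (simp add: double_diff)
qed

lemma openin_vietoris_subset:
  assumes "openin Y U"
  shows "openin (vietoris Y) {K. compactin Y K \<and> K \<subseteq> U}"
  unfolding vietoris_def using assms by (intro topology_generated_by_Basis) blast

text \<open>A proper subset of \<open>Y\<close> misses a point \<open>p\<close>, and missing \<open>p\<close> is an open condition because
  \<open>Y - {p}\<close> is open.\<close>

lemma closedin_vietoris_topspace:
  assumes "compact_space Y" "t1_space Y"
  shows "closedin (vietoris Y) {topspace Y}"
  unfolding closedin_def
proof
  \<comment> \<open>Compactness of \<open>Y\<close> is what makes the whole space a point of the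
    hyperspace.\<close>
  show "{topspace Y} \<subseteq> topspace (vietoris Y)"
    using assms(1) by (simp add: topspace_vietoris compact_space_def)
  have "topspace (vietoris Y) - {topspace Y} =
      (\<Union>p\<in>topspace Y. {K. compactin Y K \<and> K \<subseteq> topspace Y - {p}})"
    unfolding topspace_vietoris by (auto dest: compactin_subset_topspace)
  moreover have "openin Y (topspace Y - {p})" if "p \<in> topspace Y" for p
    using assms(2) that by (simp add: closedin_t1_singleton openin_diff)
  ultimately show "openin (vietoris Y) (topspace (vietoris Y) - {topspace Y})"
    by (auto intro!: openin_vietoris_subset)
qed

theorem proposition2p6:
  fixes P :: "'a topology \<Rightarrow> ('a \<Rightarrow> 'a) \<Rightarrow> ('a \<times> 'a) set"
    and X :: "'a topology"
  assumes "dynamical_pair_assignment P"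
    and "compact_space X" and "metrizable_space X"
  shows "{T \<in> topspace (self_maps X). pair_full P X T} \<in> sets (borel_of (self_maps X))"
proof -
  let ?Y = "prod_topology X X"
  have P: "P X \<in> borel_of (self_maps X) \<rightarrow>\<^sub>M borel_of (vietoris ?Y)"
    using assms by (simp add: dynamical_pair_assignment_def)
  have "compact_space ?Y" "t1_space ?Y"
    using assms(2,3)
    by (simp_all add: compact_space_prod_topology t1_space_prod_topology metrizable_imp_t1_space)
  then have "{topspace ?Y} \<in> sets (borel_of (vietoris ?Y))"
    by (intro borel_of_closed closedin_vietoris_topspace)
  \<comment> \<open>The preimage is cut down to \<open>topspace (self_maps X)\<close>, and
    \<open>topspace ?Y\<close> is the square in \<open>pair_full\<close>, so this is exactly the set
    of full maps.\<close>
  from measurable_sets[OF P this] show ?thesis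
    by (simp add: space_borel_of pair_full_def vimage_def Int_def conj_commute)
qed

end
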